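(* Let $d,m\ge 1$ be integers, $n=d+m$, let $A\in\mathbb{R}^{(d+1)\times m}$ and let $\mathcal{L}=\{(\bm{x},\widetilde{\bm{x}}A)\mid \bm{x}\in\mathbb{R}^d\}\subset\mathbb{R}^n$, where $\widetilde{\bm{x}}=(1,\bm{x})$. Suppose that $\omega(A)=\omega<n$, and let $s$ be a real number with $$\frac{\omega(d+1)-m}{\omega+1}<s\le d.$$ Then for any decreasing function $\psi:\mathbb{N}\to\mathbb{R}_{>0}$ such that $$\sum_{q=1}^\infty\psi(q)^{m+s}q^{d-s}<\infty,$$ and for any $\bm{\theta}\in\mathbb{R}^n$, we have $$\mathcal{H}^s(\mathcal{S}_n(\psi,\bm{\theta})\cap\mathcal{L})=0.$$
   Context: Vectors are row vectors; $|\cdot|$ is the supremum norm; $\|\bm{y}\|$ is the sup-norm distance of $\bm{y}$ to the nearest integer vector (also for column vectors). "Decreasing" means non-increasing. $\mathcal{H}^s$ is $s$-dimensional Hausdorff measure. The diophantine exponent $\omega(A)$ of a real matrix $A$ with $m$ columns is the supremum of all $\omega\in\mathbb{R}$ such that $\|A\bm{q}^{\mathrm T}\|<|\bm{q}|^{-\omega}$ holds for infinitely many $\bm{q}\in\mathbb{Z}^m$. $\mathcal{S}_n(\psi,\bm{\theta})=\{\bm{y}\in\mathbb{R}^n:\|q\bm{y}-\bm{\theta}\|<\psi(q)\text{ for infinitely many }q\in\mathbb{N}\}$. *)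

theory Defs
  imports "HOL-Analysis.Analysis"
begin

definition int_vectors :: "(real^'n) set" where
  "int_vectors = {z. \<forall>i. z $ i \<in> \<int>}"

text \<open>Sup-norm distance to the nearest integer vector. The sup-norm on \<open>real^'n\<close> is
  \<^const>\<open>infnorm\<close>, whereas \<^const>\<open>dist\<close> is Euclidean there.\<close>

definition dist_int :: "real^'n \<Rightarrow> real" where
  "dist_int y = (INF z\<in>int_vectors. infnorm (y - z))"

text \<open>The supremum is taken in \<^typ>\<open>ereal\<close>, as the exponent may be infinite.\<close>

definition diophantine_exponent :: "real^'m^'k \<Rightarrow> ereal" where
  "diophantine_exponent A =
     Sup {ereal w |w. infinite {q \<in> int_vectors. dist_int (A *v q) < infnorm q powr (- w)}}"

definition approximable :: "(nat \<Rightarrow> real) \<Rightarrow> real^'n \<Rightarrow> (real^'n) set" where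
  "approximable \<psi> \<theta> =
     {y. infinite {q::nat. q \<ge> 1 \<and> dist_int (real q *\<^sub>R y - \<theta>) < \<psi> q}}"

text \<open>The space of dimension \<open>d + 1\<close> is \<open>real^('d option)\<close>; the index \<^const>\<open>None\<close> is the leading
  coordinate, so that \<open>tilde x\<close> is \<open>(1, x)\<close>.\<close>

definition tilde :: "real^'d::finite \<Rightarrow> real^('d option)" where
  "tilde x = (\<chi> k. case k of None \<Rightarrow> 1 | Some i \<Rightarrow> x $ i)"

definition vec_join :: "real^'d \<Rightarrow> real^'m \<Rightarrow> real^('d + 'm)" where
  "vec_join x y = (\<chi> k. case k of Inl i \<Rightarrow> x $ i | Inr j \<Rightarrow> y $ j)"

definition affine_graph :: "real^'m^('d::finite option) \<Rightarrow> (real^('d + 'm)) set" where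
  "affine_graph A = {vec_join x (tilde x v* A) |x. True}"

text \<open>Conventions: the empty set contributes \<open>0\<close>, and \<open>0\<^sup>0 = 1\<close> for nonempty sets
  (while \<^const>\<open>powr\<close> has \<open>0 powr 0 = 0\<close>). Boundedness is required in covers because
  \<^const>\<open>diameter\<close> is unspecified on unbounded sets.\<close>

definition diam_power :: "real \<Rightarrow> 'a::metric_space set \<Rightarrow> ennreal" where
  "diam_power s U =
     (if U = {} then 0 else if s = 0 then 1 else ennreal (diameter U powr s))"

definition hausdorff_pre :: "real \<Rightarrow> real \<Rightarrow> 'a::metric_space set \<Rightarrow> ennreal" where
  "hausdorff_pre s \<delta> E =
     (INF U \<in> {U :: nat \<Rightarrow> 'a set. E \<subseteq> (\<Union>i. U i) \<and> (\<forall>i. bounded (U i) \<and> diameter (U i) \<le> \<delta>)}.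
        \<Sum>i. diam_power s (U i))"

text \<open>The limit as \<open>\<delta>\<close> tends to \<open>0\<close> from above is a supremum by monotonicity.\<close>

definition hausdorff_measure :: "real \<Rightarrow> 'a::metric_space set \<Rightarrow> ennreal" where
  "hausdorff_measure s E = (SUP \<delta> \<in> {0<..}. hausdorff_pre s \<delta> E)"

end

theory Submission
  imports Defs
begin

text \<open>
  Write \<open>D = d + 1\<close>. If \<open>y = (x, tilde x v* A)\<close> and \<open>q y - \<theta>\<close> lies within \<open>\<psi> q\<close> of an integer vector
  \<open>(a, b)\<close>, then \<open>x\<close> lies in a ball of radius \<open>\<psi> q / q\<close> around \<open>(a + \<theta>\<^sub>1) / q\<close>, and the integer vector
  \<open>r = (q, a)\<close> of dimension \<open>D\<close> makes \<open>r v* A\<close> approximate, modulo integers and up to \<open>O(\<psi> q)\<close>, a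
  vector \<open>\<beta>\<close> that depends on \<open>\<theta>\<close> and \<open>A\<close> only. So the piece of the set over a bounded range of \<open>x\<close> is a
  limsup set of small patches indexed by such \<open>r\<close>, and by the Borel--Cantelli argument
  (\<open>hausdorff_measure_limsup_eq_0\<close>) it suffices to count these \<open>r\<close>.

  The expected number of \<open>r\<close> with \<open>\<bar>r\<bar> \<le> Q\<close> and \<open>r v* A\<close> within \<open>\<delta>\<close> of \<open>\<beta>\<close> is of order
  \<open>Q^D * \<delta>^m\<close>. An upper bound of this order (\<open>card_int_vectors_near_int_le\<close>) holds as soon as
  \<open>\<delta> \<ge> Q powr (-1/w)\<close> for some \<open>w > \<omega>(A)\<close>. Its source is a duality: the vectors \<open>A *v q\<close> with \<open>q\<close> integral
  of size \<open>1/\<delta>\<close> are \<open>1/Q\<close>-separated modulo integers, because \<open>w\<close> exceeds the exponent, so they can be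
  moved to distinct points of the grid \<open>(\<int>/M)^D\<close> with \<open>M\<close> of order \<open>Q\<close>. At each of these points the
  exponential sum over the counted \<open>r\<close> has all its terms nearly aligned, hence is comparable to their number,
  while Parseval's identity on the grid bounds its mean square
  (\<open>card_mult_card_le_of_aligned_phases\<close>).

  The threshold is harmless: enlarge \<open>\<psi> q\<close> to \<open>max (\<psi> q) (q powr (-1/w))\<close>. The extra series
  \<open>\<Sum> q powr (d - s - (m + s) / w)\<close> converges exactly when \<open>s > (w * D - m) / (w + 1)\<close>, and this holds
  for \<open>w\<close> close to \<open>\<omega>(A)\<close>. On the dyadic block \<open>2^k \<le> q < 2^(k+1)\<close> the cover then costs
  \<open>(2^k)^D * \<phi> k^m * (\<phi> k / 2^k)^s\<close> with \<open>\<phi> k\<close> the enlarged value at \<open>2^k\<close>, and these costs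
  are summable by condensation.

  The counting bound applied to the single point \<open>r = 0\<close> also gives Dirichlet's lower bound
  \<open>\<omega>(A) \<ge> m / D\<close>, which is how the hypothesis on \<open>s\<close> forces \<open>s > 0\<close>.
\<close>

section \<open>Hausdorff measure of limsup sets\<close>

lemma hausdorff_pre_mono:
  assumes "E \<subseteq> F"
  shows "hausdorff_pre s \<delta> E \<le> hausdorff_pre s \<delta> F"
  unfolding hausdorff_pre_def by (rule INF_superset_mono) (use assms in auto)

lemma hausdorff_pre_le_diam_power:
  assumes "bounded U" "diameter U \<le> \<delta>" "0 \<le> \<delta>"
  shows "hausdorff_pre s \<delta> U \<le> diam_power s U"
proof -
  let ?V = "\<lambda>i::nat. if i = 0 then U else {}"
  have "(\<Sum>i. diam_power s (?V i)) = (\<Sum>i\<in>{0}. diam_power s (?V i))"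
    by (rule suminf_finite) (auto simp: diam_power_def)
  moreover have "hausdorff_pre s \<delta> U \<le> (\<Sum>i. diam_power s (?V i))"
    unfolding hausdorff_pre_def by (rule INF_lower) (use assms in auto)
  ultimately show ?thesis by simp
qed

lemma hausdorff_pre_UN_le:
  fixes E :: "nat \<Rightarrow> 'a::metric_space set"
  shows "hausdorff_pre s \<delta> (\<Union>i. E i) \<le> (\<Sum>i. hausdorff_pre s \<delta> (E i))"
proof (cases "(\<Sum>i. hausdorff_pre s \<delta> (E i)) = top")
  case False
  have fin: "hausdorff_pre s \<delta> (E i) \<noteq> top" for i
  proof
    assume "hausdorff_pre s \<delta> (E i) = top"
    moreover have "hausdorff_pre s \<delta> (E i) \<le> (\<Sum>i. hausdorff_pre s \<delta> (E i))"
      using sum_le_suminf[of "\<lambda>i. hausdorff_pre s \<delta> (E i)" "{i}"] by simp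
    ultimately show False using False by (simp add: top_unique)
  qed
  show ?thesis
  proof (rule ennreal_le_epsilon)
    fix e :: real assume e: "e > 0"
    have "\<exists>U :: nat \<Rightarrow> 'a set. E i \<subseteq> (\<Union>j. U j) \<and> (\<forall>j. bounded (U j) \<and> diameter (U j) \<le> \<delta>) \<and>
        (\<Sum>j. diam_power s (U j)) < hausdorff_pre s \<delta> (E i) + ennreal (e * (1/2) ^ Suc i)" for i
    proof -
      have "hausdorff_pre s \<delta> (E i) < hausdorff_pre s \<delta> (E i) + ennreal (e * (1/2) ^ Suc i)"
        using e fin[of i] by (simp add: less_top ennreal_zero_less_mult_iff)
      then show ?thesis
        unfolding hausdorff_pre_def[of s \<delta> "E i"] INF_less_iff by blast
    qed
    then obtain U :: "nat \<Rightarrow> nat \<Rightarrow> 'a set" where U: "\<And>i. E i \<subseteq> (\<Union>j. U i j)"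
      "\<And>i j. bounded (U i j)" "\<And>i j. diameter (U i j) \<le> \<delta>"
      "\<And>i. (\<Sum>j. diam_power s (U i j)) < hausdorff_pre s \<delta> (E i) + ennreal (e * (1/2) ^ Suc i)"
      by metis
    let ?V = "\<lambda>n. case prod_decode n of (i, j) \<Rightarrow> U i j"
    have "hausdorff_pre s \<delta> (\<Union>i. E i) \<le> (\<Sum>n. diam_power s (?V n))"
      unfolding hausdorff_pre_def
    proof (rule INF_lower, safe)
      fix x i assume "x \<in> E i"
      then obtain j where "x \<in> U i j" using U(1) by blast
      then show "x \<in> (\<Union>n. ?V n)"
        by (intro UN_I[of "prod_encode (i, j)"]) auto
    qed (auto split: prod.split intro: U)
    also have "\<dots> = (\<Sum>i. \<Sum>j. diam_power s (U i j))"
    proof -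
      have "(\<Sum>n. (\<lambda>(i, j). diam_power s (U i j)) (prod_decode n)) = (\<Sum>i. \<Sum>j. diam_power s (U i j))"
        by (rule suminf_ennreal_2dimen) simp
      then show ?thesis by (simp add: case_prod_beta)
    qed
    also have "\<dots> \<le> (\<Sum>i. hausdorff_pre s \<delta> (E i) + ennreal (e * (1/2) ^ Suc i))"
      by (intro suminf_le less_imp_le U) auto
    also have "\<dots> = (\<Sum>i. hausdorff_pre s \<delta> (E i)) + (\<Sum>i. ennreal (e * (1/2) ^ Suc i))"
      by (rule suminf_add[symmetric]) auto
    also have "(\<Sum>i. ennreal (e * (1/2) ^ Suc i)) = ennreal e"
    proof (rule suminf_ennreal_eq)
      show "(\<lambda>i. e * (1/2) ^ Suc i) sums e"
        using sums_mult[OF power_half_series, of e] by simp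
    qed (use e in auto)
    finally show "hausdorff_pre s \<delta> (\<Union>i. E i) \<le> (\<Sum>i. hausdorff_pre s \<delta> (E i)) + ennreal e" .
  qed
qed simp

lemma hausdorff_pre_empty:
  assumes "0 \<le> \<delta>" shows "hausdorff_pre s \<delta> {} = 0"
  using hausdorff_pre_le_diam_power[of "{}" \<delta> s] assms by (simp add: diam_power_def)

lemma hausdorff_pre_Un_le:
  assumes "0 \<le> \<delta>"
  shows "hausdorff_pre s \<delta> (A \<union> B) \<le> hausdorff_pre s \<delta> A + hausdorff_pre s \<delta> B"
proof -
  let ?E = "\<lambda>i::nat. if i = 0 then A else if i = 1 then B else {}"
  have "A \<union> B \<subseteq> (\<Union>i. ?E i)"
    by (auto intro: exI[of _ "0::nat"] exI[of _ "1::nat"])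
  then have "hausdorff_pre s \<delta> (A \<union> B) \<le> (\<Sum>i. hausdorff_pre s \<delta> (?E i))"
    by (rule order_trans[OF hausdorff_pre_mono hausdorff_pre_UN_le])
  also have "\<dots> = (\<Sum>i\<in>{0,1}. hausdorff_pre s \<delta> (?E i))"
    by (rule suminf_finite) (auto simp: hausdorff_pre_empty assms)
  finally show ?thesis by simp
qed

lemma hausdorff_pre_finite_UN_le:
  assumes "finite F" "0 \<le> \<delta>"
  shows "hausdorff_pre s \<delta> (\<Union>i\<in>F. E i) \<le> (\<Sum>i\<in>F. hausdorff_pre s \<delta> (E i))"
  using assms(1)
proof induction
  case (insert i F)
  then show ?case
    using order_trans[OF hausdorff_pre_Un_le[OF assms(2), of s "E i" "\<Union>i\<in>F. E i"]]
    by (auto intro: add_left_mono)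
qed (simp add: hausdorff_pre_empty assms)

lemma hausdorff_measure_UN_eq_0:
  fixes E :: "nat \<Rightarrow> 'a::metric_space set"
  assumes "\<And>i. hausdorff_measure s (E i) = 0"
  shows "hausdorff_measure s (\<Union>i. E i) = 0"
proof -
  have "hausdorff_pre s \<delta> (\<Union>i. E i) = 0" if "\<delta> > 0" for \<delta>
  proof -
    have "hausdorff_pre s \<delta> (E i) \<le> hausdorff_measure s (E i)" for i
      unfolding hausdorff_measure_def by (rule SUP_upper) (use that in auto)
    then have "hausdorff_pre s \<delta> (E i) = 0" for i using assms by (metis le_zero_eq)
    then show ?thesis using hausdorff_pre_UN_le[of s \<delta> E] by simp
  qed
  then show ?thesis unfolding hausdorff_measure_def
    by (simp add: SUP_eq_const)
qed

text \<open>The Borel--Cantelli argument: the families \<open>F k\<close> with \<open>k \<ge> K\<close> cover \<open>E\<close> for every \<open>K\<close>, so the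
  Hausdorff sums are bounded by the tails of a convergent series.\<close>

lemma hausdorff_measure_limsup_eq_0:
  fixes E :: "'a::metric_space set" and F :: "nat \<Rightarrow> 'b set" and U :: "nat \<Rightarrow> 'b \<Rightarrow> 'a set"
  assumes "s > 0"
    and finite: "\<And>k. finite (F k)"
    and bounded: "\<And>k r. r \<in> F k \<Longrightarrow> bounded (U k r)"
    and diam: "\<And>k r. r \<in> F k \<Longrightarrow> diameter (U k r) \<le> \<rho> k"
    and \<rho>: "\<And>k. \<rho> k \<ge> 0" "\<rho> \<longlonglongrightarrow> 0"
    and summable: "summable (\<lambda>k. real (card (F k)) * \<rho> k powr s)"
    and E: "\<And>y. y \<in> E \<Longrightarrow> infinite {k. y \<in> (\<Union>r\<in>F k. U k r)}"
  shows "hausdorff_measure s E = 0"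
proof -
  let ?a = "\<lambda>k. real (card (F k)) * \<rho> k powr s"
  have "hausdorff_pre s \<delta> E = 0" if \<delta>: "\<delta> > 0" for \<delta>
  proof -
    have "\<forall>\<^sub>F k in sequentially. \<rho> k < \<delta>" using \<rho>(2) \<delta> by (rule order_tendstoD)
    then obtain K where K: "\<And>k. k \<ge> K \<Longrightarrow> \<rho> k \<le> \<delta>"
      by (auto simp: eventually_sequentially intro: less_imp_le)
    have le: "hausdorff_pre s \<delta> E \<le> ennreal (\<Sum>i. ?a (i + k))" if "k \<ge> K" for k
    proof -
      have "E \<subseteq> (\<Union>i. \<Union>r\<in>F (i + k). U (i + k) r)"
      proof
        fix y assume "y \<in> E"
        then have "\<exists>j\<ge>k. j \<in> {k. y \<in> (\<Union>r\<in>F k. U k r)}"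
          using E[of y] unfolding infinite_nat_iff_unbounded_le by blast
        then obtain j where "j \<ge> k" "y \<in> (\<Union>r\<in>F j. U j r)" by blast
        then show "y \<in> (\<Union>i. \<Union>r\<in>F (i + k). U (i + k) r)"
          by (intro UN_I[of "j - k"]) auto
      qed
      then have "hausdorff_pre s \<delta> E \<le> (\<Sum>i. hausdorff_pre s \<delta> (\<Union>r\<in>F (i + k). U (i + k) r))"
        by (rule order_trans[OF hausdorff_pre_mono hausdorff_pre_UN_le])
      also have "\<dots> \<le> (\<Sum>i. ennreal (?a (i + k)))"
      proof (rule suminf_le)
        fix i
        let ?k = "i + k"
        have "hausdorff_pre s \<delta> (\<Union>r\<in>F ?k. U ?k r) \<le> (\<Sum>r\<in>F ?k. hausdorff_pre s \<delta> (U ?k r))"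
          by (rule hausdorff_pre_finite_UN_le) (use finite \<delta> in auto)
        also have "\<dots> \<le> (\<Sum>r\<in>F ?k. ennreal (\<rho> ?k powr s))"
        proof (rule sum_mono)
          fix r assume r: "r \<in> F ?k"
          have "hausdorff_pre s \<delta> (U ?k r) \<le> diam_power s (U ?k r)"
            using diam[OF r] K[of ?k] \<open>k \<ge> K\<close> \<delta> bounded[OF r]
            by (intro hausdorff_pre_le_diam_power) auto
          also have "\<dots> \<le> ennreal (\<rho> ?k powr s)"
            using \<open>s > 0\<close> diam[OF r] diameter_ge_0[OF bounded[OF r]]
            by (auto simp: diam_power_def intro!: ennreal_leI powr_mono2)
          finally show "hausdorff_pre s \<delta> (U ?k r) \<le> ennreal (\<rho> ?k powr s)" .
        qed
        also have "\<dots> = ennreal (?a ?k)"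
          by (simp add: ennreal_mult ennreal_of_nat_eq_real_of_nat)
        finally show "hausdorff_pre s \<delta> (\<Union>r\<in>F ?k. U ?k r) \<le> ennreal (?a ?k)" .
      qed auto
      also have "\<dots> = ennreal (\<Sum>i. ?a (i + k))"
        using summable by (intro suminf_ennreal2) (auto simp: summable_iff_shift[of ?a])
      finally show ?thesis .
    qed
    have "(\<lambda>k. \<Sum>i. ?a (i + k)) \<longlonglongrightarrow> 0"
      using summable by (rule suminf_exist_split2)
    then have "(\<lambda>k. ennreal (\<Sum>i. ?a (i + k))) \<longlonglongrightarrow> ennreal 0"
      by (rule tendsto_ennrealI)
    then have "hausdorff_pre s \<delta> E \<le> ennreal 0"
      by (rule LIMSEQ_le_const) (use le in blast)
    then show ?thesis by simp
  qed
  then show ?thesis unfolding hausdorff_measure_def by (simp add: SUP_eq_const)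
qed

section \<open>A counting inequality from Fourier analysis on a finite grid\<close>

lemma sum_cis_eq_0:
  fixes x :: int and M :: nat
  assumes "\<not> int M dvd x" and "M > 0"
  shows "(\<Sum>j<M. cis (2 * pi * (real_of_int x * real j / real M))) = 0"
proof -
  let ?z = "cis (2 * pi * (real_of_int x / real M))"
  have pow: "?z ^ j = cis (2 * pi * (real_of_int x * real j / real M))" for j
    by (subst Complex.DeMoivre) (simp add: mult_ac)
  have "?z \<noteq> 1"
  proof
    assume "?z = 1"
    then have "cos (2 * pi * (real_of_int x / real M)) = 1" by (simp add: complex_eq_iff)
    then obtain n :: int where "2 * pi * (real_of_int x / real M) = of_int n * 2 * pi"
      by (auto simp: cos_one_2pi_int)
    then have "real_of_int x = of_int (n * int M)" using assms by (simp add: field_simps)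
    then have "x = n * int M" by linarith
    then show False using assms by simp
  qed
  moreover have "?z ^ M = 1"
    unfolding pow using assms cis_multiple_2pi[of "real_of_int x"] by simp
  ultimately have "(\<Sum>j<M. ?z ^ j) = 0"
    by (simp add: geometric_sum)
  moreover have "(\<Sum>j<M. cis (2 * pi * (real_of_int x * real j / real M))) = (\<Sum>j<M. ?z ^ j)"
    by (intro sum.cong refl pow[symmetric])
  ultimately show ?thesis by simp
qed

lemma cis_sum: "finite A \<Longrightarrow> cis (sum f A) = (\<Prod>x\<in>A. cis (f x))"
  by (induction rule: finite_induct) (auto simp: cis_mult[symmetric])

text \<open>Parseval's identity on \<open>(\<int>/M)^k\<close> for a sum of distinct characters.\<close>

lemma sum_power2_norm_trigonometric_sum:
  fixes S :: "'a set" and r :: "'a \<Rightarrow> 'k::finite \<Rightarrow> int" and M :: nat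
  assumes "finite S" "M > 0"
    and sep: "\<And>a b. a \<in> S \<Longrightarrow> b \<in> S \<Longrightarrow> (\<And>k. int M dvd r a k - r b k) \<Longrightarrow> a = b"
  shows "(\<Sum>g\<in>PiE UNIV (\<lambda>_. {..<M}).
            (cmod (\<Sum>a\<in>S. cis (2 * pi * (\<Sum>k\<in>UNIV. r a k * real (g k) / real M))))\<^sup>2)
         = real M ^ CARD('k) * real (card S)"
proof -
  let ?G = "PiE (UNIV :: 'k set) (\<lambda>_. {..<M})"
  let ?x = "\<lambda>a g. 2 * pi * (\<Sum>k\<in>UNIV. r a k * real (g k) / real M)"
  have fin: "finite ?G" by (rule finite_PiE) auto
  have orth: "(\<Sum>g\<in>?G. cis (?x a g - ?x b g)) = (if a = b then of_nat M ^ CARD('k) else 0)"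
    if "a \<in> S" "b \<in> S" for a b
  proof -
    have "cis (?x a g - ?x b g)
        = (\<Prod>k\<in>UNIV. cis (2 * pi * (real_of_int (r a k - r b k) * real (g k) / real M)))" for g
      by (subst cis_sum[symmetric])
         (auto simp: sum_distrib_left sum_subtractf[symmetric] diff_divide_distrib algebra_simps)
    then have "(\<Sum>g\<in>?G. cis (?x a g - ?x b g))
        = (\<Prod>k\<in>UNIV. \<Sum>j<M. cis (2 * pi * (real_of_int (r a k - r b k) * real j / real M)))"
      by (subst prod_sum_PiE) auto
    also have "\<dots> = (if a = b then of_nat M ^ CARD('k) else 0)"
    proof (cases "a = b")
      case False
      then obtain k where "\<not> int M dvd r a k - r b k" using sep \<open>a \<in> S\<close> \<open>b \<in> S\<close> by blast
      then have "(\<Sum>j<M. cis (2 * pi * (real_of_int (r a k - r b k) * real j / real M))) = 0"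
        using \<open>M > 0\<close> by (rule sum_cis_eq_0)
      then show ?thesis using False by (auto intro: prod_zero)
    qed simp
    finally show ?thesis .
  qed
  have "complex_of_real (\<Sum>g\<in>?G. (cmod (\<Sum>a\<in>S. cis (?x a g)))\<^sup>2)
      = (\<Sum>g\<in>?G. \<Sum>a\<in>S. \<Sum>b\<in>S. cis (?x a g - ?x b g))"
    by (simp add: complex_norm_square sum_product cis_cnj cis_mult cnj_sum del: of_real_power)
  also have "\<dots> = (\<Sum>a\<in>S. \<Sum>b\<in>S. \<Sum>g\<in>?G. cis (?x a g - ?x b g))"
    by (subst sum.swap) (rule sum.cong[OF refl], rule sum.swap)
  also have "\<dots> = (\<Sum>a\<in>S. \<Sum>b\<in>S. if a = b then of_nat M ^ CARD('k) else 0)"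
    by (intro sum.cong refl orth)
  also have "\<dots> = complex_of_real (real M ^ CARD('k) * real (card S))"
    using \<open>finite S\<close> by (simp add: mult.commute)
  finally show ?thesis by (simp only: of_real_eq_iff)
qed

lemma cos_2pi_ge_half:
  fixes x :: real and z :: int
  assumes "\<bar>x - z\<bar> \<le> 1/6"
  shows "cos (2 * pi * x) \<ge> 1/2"
proof -
  have "cos (2 * pi * x) = cos (2 * pi * (x - z))"
    using cos.plus_of_int[of "2 * pi * (x - z)" z] by (simp add: algebra_simps)
  also have "\<dots> = cos (2 * pi * \<bar>x - z\<bar>)"
    using cos_minus[of "2 * pi * (x - z)"] by (auto simp: abs_if algebra_simps)
  also have "\<dots> \<ge> cos (pi / 3)"
    using assms pi_gt_zero mult_left_mono[OF assms, of "2 * pi"] by (intro cos_monotone_0_pi_le) auto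
  finally show ?thesis by (simp add: cos_60)
qed

text \<open>At every grid point \<open>g t\<close> the characters indexed by \<open>S\<close> agree up to an angle of \<open>\<pi>/3\<close> with the common
  phase \<open>c t\<close>, so their sum has modulus at least \<open>card S / 2\<close>. The \<open>card T\<close> grid points together contribute
  at least \<open>card T * (card S)\<^sup>2 / 4\<close> to the square sum \<open>M^k * card S\<close> given by Parseval's identity.\<close>

lemma card_mult_card_le_of_aligned_phases:
  fixes S :: "'a set" and T :: "'b set" and r :: "'a \<Rightarrow> 'k::finite \<Rightarrow> int"
    and g :: "'b \<Rightarrow> 'k \<Rightarrow> nat" and c :: "'b \<Rightarrow> real" and M :: nat
  assumes "finite S" "M > 0"
    and sep: "\<And>a b. a \<in> S \<Longrightarrow> b \<in> S \<Longrightarrow> (\<And>k. int M dvd r a k - r b k) \<Longrightarrow> a = b"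
    and g: "inj_on g T" "\<And>t k. t \<in> T \<Longrightarrow> g t k < M"
    and phase: "\<And>a t. a \<in> S \<Longrightarrow> t \<in> T \<Longrightarrow>
      \<exists>z::int. \<bar>(\<Sum>k\<in>UNIV. r a k * real (g t k) / real M) - c t - z\<bar> \<le> 1/6"
  shows "real (card S) * real (card T) \<le> 4 * real M ^ CARD('k)"
proof (cases "S = {}")
  case False
  let ?G = "PiE (UNIV :: 'k set) (\<lambda>_. {..<M})"
  define P where "P g = (\<Sum>a\<in>S. cis (2 * pi * (\<Sum>k\<in>UNIV. r a k * real (g k) / real M)))"
    for g :: "'k \<Rightarrow> nat"
  have fin: "finite ?G" by (rule finite_PiE) auto
  have gT: "g ` T \<subseteq> ?G" using g(2) by auto
  have lower: "(real (card S) / 2)\<^sup>2 \<le> (cmod (P (g t)))\<^sup>2" if t: "t \<in> T" for t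
  proof (rule power_mono)
    let ?y = "\<lambda>a. (\<Sum>k\<in>UNIV. r a k * real (g t k) / real M) - c t"
    have "real (card S) / 2 = (\<Sum>a\<in>S. 1/2)" by simp
    also have "\<dots> \<le> (\<Sum>a\<in>S. cos (2 * pi * ?y a))"
      using phase[OF _ t] cos_2pi_ge_half by (intro sum_mono) blast
    also have "\<dots> = Re (\<Sum>a\<in>S. cis (2 * pi * ?y a))" by simp
    also have "\<dots> \<le> cmod (\<Sum>a\<in>S. cis (2 * pi * ?y a))" by (rule complex_Re_le_cmod)
    also have "(\<Sum>a\<in>S. cis (2 * pi * ?y a)) = cis (- (2 * pi * c t)) * P (g t)"
      by (simp add: P_def sum_distrib_left cis_mult algebra_simps)
    also have "cmod \<dots> = cmod (P (g t))" by (simp add: norm_mult)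
    finally show "real (card S) / 2 \<le> cmod (P (g t))" .
  qed simp
  have "real (card T) * (real (card S) / 2)\<^sup>2 = (\<Sum>t\<in>T. (real (card S) / 2)\<^sup>2)" by simp
  also have "\<dots> \<le> (\<Sum>t\<in>T. (cmod (P (g t)))\<^sup>2)" by (intro sum_mono lower)
  also have "\<dots> = (\<Sum>h\<in>g ` T. (cmod (P h))\<^sup>2)" by (simp add: sum.reindex g(1))
  also have "\<dots> \<le> (\<Sum>h\<in>?G. (cmod (P h))\<^sup>2)"
    using fin gT by (intro sum_mono2) auto
  also have "\<dots> = real M ^ CARD('k) * real (card S)"
    unfolding P_def using assms(1,2) sep by (rule sum_power2_norm_trigonometric_sum)
  finally have "real (card S) * (real (card S) * real (card T)) \<le> real (card S) * (4 * real M ^ CARD('k))"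
    by (simp add: power2_eq_square algebra_simps)
  moreover have "card S > 0" using False \<open>finite S\<close> by (simp add: card_gt_0_iff)
  ultimately show ?thesis by simp
qed simp

section \<open>Distance to the integer vectors and the exponent\<close>

lemma infnorm_cart_less_iff: "infnorm (x :: real^'n) < c \<longleftrightarrow> (\<forall>i. \<bar>x $ i\<bar> < c)"
proof -
  have eq: "{\<bar>x $ i\<bar> |i. i \<in> UNIV} = range (\<lambda>i. \<bar>x $ i\<bar>)" by auto
  show ?thesis unfolding infnorm_cart eq by (subst finite_Sup_less_iff) auto
qed

lemma infnorm_cart_le_iff: "infnorm (x :: real^'n) \<le> c \<longleftrightarrow> (\<forall>i. \<bar>x $ i\<bar> \<le> c)"
proof -
  have eq: "{\<bar>x $ i\<bar> |i. i \<in> UNIV} = range (\<lambda>i. \<bar>x $ i\<bar>)" by auto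
  show ?thesis unfolding infnorm_cart eq by (subst cSup_le_iff) auto
qed

lemma dist_int_le:
  assumes "z \<in> int_vectors" shows "dist_int y \<le> infnorm (y - z)"
  unfolding dist_int_def
  by (rule cINF_lower[OF _ assms]) (auto intro!: bdd_belowI[of _ 0] infnorm_pos_le)

lemma zero_in_int_vectors [simp]: "0 \<in> int_vectors"
  by (simp add: int_vectors_def)

lemma int_vectors_nonempty [simp]: "int_vectors \<noteq> {}"
  using zero_in_int_vectors by blast

lemma dist_int_nonneg: "0 \<le> dist_int y"
  unfolding dist_int_def by (rule cINF_greatest) (auto intro: infnorm_pos_le zero_in_int_vectors)

lemma dist_int_lessE:
  assumes "dist_int y < e"
  obtains z where "z \<in> int_vectors" "infnorm (y - z) < e"
  using assms zero_in_int_vectors unfolding dist_int_def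
  by (subst (asm) cINF_less_iff) (auto intro!: bdd_belowI[of _ 0] infnorm_pos_le)

lemma dist_int_scaleR_nat_le: "dist_int (real k *\<^sub>R y) \<le> real k * dist_int y"
proof (cases "k = 0")
  case True
  then show ?thesis using dist_int_le[of 0 "0 :: real^'a"] by (simp add: infnorm_0)
next
  case False
  have "dist_int (real k *\<^sub>R y) / real k \<le> infnorm (y - z)" if "z \<in> int_vectors" for z
  proof -
    have "dist_int (real k *\<^sub>R y) \<le> infnorm (real k *\<^sub>R y - real k *\<^sub>R z)"
      using that by (intro dist_int_le) (auto simp: int_vectors_def)
    also have "\<dots> = real k * infnorm (y - z)"
      by (simp add: scaleR_diff_right[symmetric] infnorm_mul)
    finally show ?thesis using False by (simp add: divide_le_eq mult.commute)
  qed
  then have "dist_int (real k *\<^sub>R y) / real k \<le> dist_int y"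
    unfolding dist_int_def[of y] using zero_in_int_vectors by (intro cINF_greatest) auto
  then show ?thesis using False by (simp add: divide_le_eq mult.commute)
qed

text \<open>Beyond the exponent only finitely many \<open>q\<close> violate \<open>\<parallel>A q\<parallel> \<ge> \<bar>q\<bar>^(-w)\<close>, and shrinking the constant
  absorbs them provided that \<open>\<parallel>A q\<parallel> > 0\<close> for \<open>q \<noteq> 0\<close>. This positivity is automatic: if \<open>\<parallel>A q\<parallel> = 0\<close>, then
  all positive multiples of \<open>q\<close> would violate the inequality too.\<close>

lemma diophantine_exponent_less_imp_lower_bound:
  fixes A :: "real^'m^'k"
  assumes "diophantine_exponent A < ereal w"
  obtains c where "c > 0"
    "\<And>q. q \<in> int_vectors \<Longrightarrow> q \<noteq> 0 \<Longrightarrow> c * infnorm q powr (-w) \<le> dist_int (A *v q)"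
proof -
  define X where "X = {q \<in> int_vectors. dist_int (A *v q) < infnorm q powr (- w)}"
  have "finite X"
  proof (rule ccontr)
    assume "infinite X"
    then have "ereal w \<le> diophantine_exponent A"
      unfolding X_def diophantine_exponent_def by (intro Sup_upper) blast
    then show False using assms by simp
  qed
  have pos: "dist_int (A *v q) > 0" if q: "q \<in> int_vectors" "q \<noteq> 0" for q
  proof (rule ccontr)
    assume "\<not> dist_int (A *v q) > 0"
    then have 0: "dist_int (A *v q) = 0" using dist_int_nonneg[of "A *v q"] by linarith
    have "(\<lambda>k. real (Suc k) *\<^sub>R q) ` UNIV \<subseteq> X"
    proof safe
      fix k
      have "dist_int (A *v (real (Suc k) *\<^sub>R q)) \<le> real (Suc k) * dist_int (A *v q)"
        unfolding matrix_vector_mult_scaleR by (rule dist_int_scaleR_nat_le)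
      also have "\<dots> < infnorm (real (Suc k) *\<^sub>R q) powr (- w)"
        using 0 q infnorm_eq_0[of "real (Suc k) *\<^sub>R q"] by simp
      finally show "real (Suc k) *\<^sub>R q \<in> X"
        using q(1) unfolding X_def by (auto simp: int_vectors_def simp del: of_nat_Suc)
    qed
    moreover have "inj (\<lambda>k. real (Suc k) *\<^sub>R q)"
      using q(2) by (auto simp: inj_on_def)
    ultimately show False using \<open>finite X\<close>
      by (meson finite_imageD finite_subset infinite_UNIV_nat)
  qed
  define Y where "Y = insert 1 ((\<lambda>q. dist_int (A *v q) * infnorm q powr w) ` (X - {0}))"
  have Y: "finite Y" "Y \<noteq> {}" using \<open>finite X\<close> by (auto simp: Y_def)
  show thesis
  proof
    show "Min Y > 0"
      using Y pos infnorm_pos_lt by (auto simp: Y_def X_def Min_gr_iff infnorm_eq_0)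
    fix q :: "real^'m" assume q: "q \<in> int_vectors" "q \<noteq> 0"
    have qp: "infnorm q > 0" using q infnorm_pos_lt by auto
    show "Min Y * infnorm q powr (- w) \<le> dist_int (A *v q)"
    proof (cases "q \<in> X")
      case True
      then have "Min Y \<le> dist_int (A *v q) * infnorm q powr w"
        using q Y by (intro Min_le) (auto simp: Y_def)
      then have "Min Y * infnorm q powr (-w) \<le> dist_int (A *v q) * infnorm q powr w * infnorm q powr (-w)"
        by (rule mult_right_mono) auto
      also have "\<dots> = dist_int (A *v q)"
        using qp by (simp add: mult.assoc powr_add[symmetric])
      finally show ?thesis .
    next
      case False
      have "Min Y \<le> 1" using Y by (intro Min_le) (auto simp: Y_def)
      then have "Min Y * infnorm q powr (-w) \<le> 1 * infnorm q powr (-w)"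
        by (rule mult_right_mono) auto
      also have "\<dots> \<le> dist_int (A *v q)" using False q by (auto simp: X_def)
      finally show ?thesis .
    qed
  qed
qed

section \<open>Counting integer vectors with prescribed image modulo integers\<close>

text \<open>Test the vectors \<open>r \<in> S\<close> against the integer vectors \<open>q\<close> in the cube \<open>{0..<N}^m\<close> with \<open>N\<close> of order
  \<open>1/\<delta>\<close>: since \<open>r v* A\<close> is within \<open>\<delta>\<close> of \<open>\<beta>\<close> modulo integers, the phase \<open>r \<bullet> (A *v q)\<close> is close to
  \<open>\<beta> \<bullet> q\<close> modulo 1, whatever \<open>r\<close>. Rounding \<open>A *v q\<close> down to the grid of mesh \<open>1/M\<close> with \<open>M\<close> of order \<open>Q\<close>
  changes these phases only little, and the rounded points are distinct modulo 1 because
  \<open>\<parallel>A (q - q')\<parallel>\<close> is at least of order \<open>\<delta>^w \<ge> 1/Q\<close>. The inequality of the previous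
  section then gives \<open>card S * N^m \<le> 4 * M^k\<close>.\<close>

lemma card_int_vectors_near_int_le:
  fixes A :: "real^'m^'k"
  assumes c: "c > 0" and w: "w > 0"
    and A: "\<And>q. q \<in> int_vectors \<Longrightarrow> q \<noteq> 0 \<Longrightarrow> c * infnorm q powr (-w) \<le> dist_int (A *v q)"
  obtains C where "C > 0"
    "\<And>Q \<delta> \<beta> S. Q \<ge> 1 \<Longrightarrow> \<delta> > 0 \<Longrightarrow> Q powr (-1/w) \<le> \<delta> \<Longrightarrow>
      S \<subseteq> {r \<in> int_vectors. infnorm r \<le> Q \<and> dist_int (r v* A - \<beta>) < \<delta>} \<Longrightarrow> finite S \<Longrightarrow>
      real (card S) \<le> C * Q ^ CARD('k) * \<delta> ^ CARD('m)"
proof -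
  let ?m = "CARD('m)" and ?D = "CARD('k)"
  \<comment> \<open>The factor 12 in \<open>\<kappa>\<close> and \<open>K\<close> lets each of the two phase errors be at most \<open>1/12\<close>, which
    leaves \<open>1/6\<close> in total; the second term of the maximum separates the rounded points.\<close>
  define \<kappa> :: real where "\<kappa> = 1 / (12 * real ?m)"
  define K where "K = max (12 * real ?D) (\<kappa> powr w / c)"
  have \<kappa>: "\<kappa> > 0" by (simp add: \<kappa>_def)
  have K: "K \<ge> 12 * real ?D" "K \<ge> \<kappa> powr w / c" by (auto simp: K_def)
  have D1: "real ?D \<ge> 1" using zero_less_card_finite[where 'a='k] by linarith
  have K12: "K \<ge> 12" using K(1) D1 by linarith
  define C where "C = 4 * (K + 1) ^ ?D / \<kappa> ^ ?m"
  show thesis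
  proof
    show "C > 0" using \<kappa> K12 by (simp add: C_def)
    fix Q \<delta> :: real and \<beta> :: "real^'m" and S :: "(real^'k) set"
    assume Q: "Q \<ge> 1" and \<delta>: "\<delta> > 0" and Q\<delta>: "Q powr (-1/w) \<le> \<delta>"
      and S: "S \<subseteq> {r \<in> int_vectors. infnorm r \<le> Q \<and> dist_int (r v* A - \<beta>) < \<delta>}"
      and finS: "finite S"
    define M where "M = nat \<lceil>K * Q\<rceil>"
    \<comment> \<open>The summand 1 gives \<open>N \<ge> \<kappa> / \<delta>\<close>, while the entries of \<open>q\<close>, being at most \<open>N - 1\<close>, stay below \<open>\<kappa> / \<delta>\<close>.\<close>
    define N where "N = nat \<lfloor>\<kappa> / \<delta>\<rfloor> + 1"
    have KQ: "K * Q \<ge> 12 * Q" "K * Q > 0" using K12 Q by auto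
    have M: "real M \<ge> K * Q" "real M \<le> (K + 1) * Q" "M > 0"
      using Q KQ unfolding M_def by (auto simp: algebra_simps; linarith)+
    have N: "real N \<ge> \<kappa> / \<delta>" "real N - 1 \<le> \<kappa> / \<delta>"
      using \<kappa> \<delta> unfolding N_def by (auto; linarith)+
    define T where "T = PiE (UNIV :: 'm set) (\<lambda>_. {..<N})"
    define vec where "vec f = (\<chi> j. real (f j))" for f :: "'m \<Rightarrow> nat"
    define fl where "fl f k = \<lfloor>real M * (A *v vec f) $ k\<rfloor>" for f k
    define g where "g f k = nat (fl f k mod int M)" for f k
    have g_eq: "int (g f k) = fl f k mod int M" for f k
      using M by (simp add: g_def)
    have fl_bounds: "real_of_int (fl f k) / M \<le> (A *v vec f) $ k"
      "(A *v vec f) $ k < real_of_int (fl f k) / M + 1 / M" for f k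
    proof -
      have "real_of_int (fl f k) \<le> real M * (A *v vec f) $ k"
        "real M * (A *v vec f) $ k < real_of_int (fl f k) + 1"
        unfolding fl_def by linarith+
      then show "real_of_int (fl f k) / M \<le> (A *v vec f) $ k"
        "(A *v vec f) $ k < real_of_int (fl f k) / M + 1 / M"
        using M by (auto simp: field_simps)
    qed
    have "real (card S) * real (card T) \<le> 4 * real M ^ ?D"
    proof (rule card_mult_card_le_of_aligned_phases)
      show "finite S" "M > 0" by fact+
      show "g f k < M" for f k using M by (simp add: g_def nat_less_iff)
      show "a = b" if "a \<in> S" "b \<in> S" and dvd: "\<And>k. int M dvd \<lfloor>a $ k\<rfloor> - \<lfloor>b $ k\<rfloor>" for a b
        unfolding vec_eq_iff
      proof
        fix k
        have ab: "a $ k \<in> \<int>" "b $ k \<in> \<int>" "\<bar>a $ k\<bar> \<le> Q" "\<bar>b $ k\<bar> \<le> Q"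
          using that(1,2) S component_le_infnorm_cart[of a k] component_le_infnorm_cart[of b k]
          by (auto simp: int_vectors_def intro: order_trans)
        have eq: "real_of_int \<lfloor>a $ k\<rfloor> = a $ k" "real_of_int \<lfloor>b $ k\<rfloor> = b $ k"
          using ab by (auto elim: Ints_cases)
        have "real_of_int \<bar>\<lfloor>a $ k\<rfloor> - \<lfloor>b $ k\<rfloor>\<bar> \<le> 2 * Q" using ab eq by (simp; linarith)
        also have "\<dots> < real M" using M KQ Q by linarith
        finally have small: "\<bar>\<lfloor>a $ k\<rfloor> - \<lfloor>b $ k\<rfloor>\<bar> < int M" by linarith
        have "\<lfloor>a $ k\<rfloor> - \<lfloor>b $ k\<rfloor> = 0"
        proof (rule ccontr)
          assume "\<lfloor>a $ k\<rfloor> - \<lfloor>b $ k\<rfloor> \<noteq> 0"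
          from dvd_imp_le_int[OF this dvd] show False using small by simp
        qed
        then show "a $ k = b $ k" using eq by linarith
      qed
      show "inj_on g T"
      proof (rule inj_onI, rule ccontr)
        fix f f' assume f: "f \<in> T" "f' \<in> T" and gg: "g f = g f'" and ne: "f \<noteq> f'"
        define u where "u = vec f - vec f'"
        have u: "u \<in> int_vectors" by (simp add: u_def vec_def int_vectors_def)
        obtain j where "f j \<noteq> f' j" using ne by blast
        then have "u $ j \<noteq> 0" by (simp add: u_def vec_def)
        then have u0: "u \<noteq> 0" by auto
        then have upos: "infnorm u > 0" by (simp add: infnorm_pos_lt)
        have "\<bar>u $ j\<bar> \<le> \<kappa> / \<delta>" for j
        proof -
          have "f j < N" "f' j < N" using f by (auto simp: T_def)
          then have "\<bar>real (f j) - real (f' j)\<bar> \<le> real N - 1" by linarith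
          then show ?thesis using N by (simp add: u_def vec_def)
        qed
        then have ule: "infnorm u \<le> \<kappa> / \<delta>" by (simp add: infnorm_cart_le_iff)
        define z :: "real^'k" where "z = (\<chi> k. real_of_int ((fl f k - fl f' k) div int M))"
        have "\<bar>(A *v u - z) $ k\<bar> < 1 / real M" for k
        proof -
          have "fl f k mod int M = fl f' k mod int M" using gg g_eq by metis
          then have "int M dvd fl f k - fl f' k" by (simp add: mod_eq_dvd_iff)
          then have "fl f k - fl f' k = int M * ((fl f k - fl f' k) div int M)" by simp
          then have "real_of_int (fl f k) - real_of_int (fl f' k) = real M * z $ k"
            unfolding z_def by (metis of_int_diff of_int_mult of_int_of_nat_eq vec_lambda_beta)
          then have "real_of_int (fl f k) / M - real_of_int (fl f' k) / M = z $ k"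
            using M by (simp add: field_simps)
          moreover have "(A *v u) $ k = (A *v vec f) $ k - (A *v vec f') $ k"
            by (simp add: u_def matrix_vector_mult_diff_distrib)
          ultimately show ?thesis using fl_bounds[of f k] fl_bounds[of f' k]
            by (simp add: abs_less_iff)
        qed
        then have "infnorm (A *v u - z) < 1 / real M" by (simp add: infnorm_cart_less_iff)
        moreover have "z \<in> int_vectors" by (simp add: z_def int_vectors_def)
        ultimately have "dist_int (A *v u) < 1 / real M" using dist_int_le[of z "A *v u"] by linarith
        also have "\<dots> \<le> 1 / (K * Q)" using M KQ by (intro divide_left_mono) auto
        also have "\<dots> \<le> 1 / ((\<kappa> powr w / c) * Q)"
          using K(2) Q \<kappa> c KQ by (intro divide_left_mono mult_right_mono) auto
        also have "\<dots> = c * \<kappa> powr (-w) * Q powr (-1)"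
          using Q c \<kappa> by (simp add: powr_minus field_simps)
        also have "\<dots> \<le> c * \<kappa> powr (-w) * \<delta> powr w"
        proof (rule mult_left_mono)
          have "Q powr (-1) = (Q powr (-1/w)) powr w" using w by (simp add: powr_powr)
          also have "\<dots> \<le> \<delta> powr w" using Q\<delta> w by (intro powr_mono2) auto
          finally show "Q powr (-1) \<le> \<delta> powr w" .
        qed (use c in auto)
        also have "c * \<kappa> powr (-w) * \<delta> powr w = c * (\<kappa> / \<delta>) powr (-w)"
          using \<kappa> \<delta> by (simp add: powr_divide powr_minus field_simps)
        also have "\<dots> \<le> c * infnorm u powr (-w)"
          using c w ule upos by (intro mult_left_mono powr_mono2') auto
        also have "\<dots> \<le> dist_int (A *v u)" by (rule A[OF u u0])
        finally show False using c by simp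
      qed
      show "\<exists>z::int. \<bar>(\<Sum>k\<in>UNIV. \<lfloor>a $ k\<rfloor> * real (g f k) / real M) - (\<Sum>j\<in>UNIV. \<beta> $ j * real (f j)) - z\<bar> \<le> 1/6"
        if a: "a \<in> S" and f: "f \<in> T" for a f
      proof -
        have "dist_int (a v* A - \<beta>) < \<delta>" using a S by auto
        then obtain z where z: "z \<in> int_vectors" "infnorm (a v* A - \<beta> - z) < \<delta>"
          by (rule dist_int_lessE)
        have aZ: "real_of_int \<lfloor>a $ k\<rfloor> = a $ k" for k
          using a S by (auto simp: int_vectors_def elim!: Ints_cases dest!: spec[of _ k] subsetD)
        have aQ: "\<bar>a $ k\<bar> \<le> Q" for k
          using a S component_le_infnorm_cart[of a k] by auto
        have zZ: "real_of_int \<lfloor>z $ j\<rfloor> = z $ j" for j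
          using z(1) by (auto simp: int_vectors_def elim!: Ints_cases dest!: spec[of _ j])
        \<comment> \<open>\<open>e\<close> is the rounding error, and \<open>Z\<close> collects all integers in the phase.\<close>
        define e where "e k = (A *v vec f) $ k - real_of_int (fl f k) / M" for k
        have e: "\<bar>e k\<bar> \<le> 1 / M" for k using fl_bounds[of f k] by (simp add: e_def)
        define Z where "Z = (\<Sum>j\<in>UNIV. \<lfloor>z $ j\<rfloor> * int (f j)) - (\<Sum>k\<in>UNIV. \<lfloor>a $ k\<rfloor> * (fl f k div int M))"
        have gM: "real (g f k) / M = (A *v vec f) $ k - e k - (fl f k div int M)" for k
        proof -
          have "fl f k = int M * (fl f k div int M) + int (g f k)" by (simp add: g_eq)
          then have "real_of_int (fl f k) = real M * (fl f k div int M) + real (g f k)"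
            by (metis of_int_add of_int_mult of_int_of_nat_eq)
          then show ?thesis using M by (simp add: e_def field_simps)
        qed
        have swap: "(\<Sum>k\<in>UNIV. a $ k * (A *v vec f) $ k) = (\<Sum>j\<in>UNIV. (a v* A) $ j * real (f j))"
        proof -
          have "(\<Sum>k\<in>UNIV. a $ k * (A *v vec f) $ k)
              = (\<Sum>k\<in>UNIV. \<Sum>j\<in>UNIV. a $ k * A $ k $ j * real (f j))"
            by (simp add: matrix_vector_mult_def vec_def sum_distrib_left mult_ac)
          also have "\<dots> = (\<Sum>j\<in>UNIV. \<Sum>k\<in>UNIV. a $ k * A $ k $ j * real (f j))"
            by (rule sum.swap)
          also have "\<dots> = (\<Sum>j\<in>UNIV. (a v* A) $ j * real (f j))"
            by (simp add: vector_matrix_mult_def sum_distrib_right)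
          finally show ?thesis .
        qed
        have "(\<Sum>k\<in>UNIV. \<lfloor>a $ k\<rfloor> * real (g f k) / real M)
            = (\<Sum>k\<in>UNIV. a $ k * (A *v vec f) $ k - a $ k * e k - \<lfloor>a $ k\<rfloor> * (fl f k div int M))"
          by (intro sum.cong refl, subst times_divide_eq_right[symmetric], subst gM)
             (simp add: aZ algebra_simps)
        also have "\<dots> = (\<Sum>j\<in>UNIV. (a v* A) $ j * real (f j)) - (\<Sum>k\<in>UNIV. a $ k * e k)
            - (\<Sum>k\<in>UNIV. \<lfloor>a $ k\<rfloor> * (fl f k div int M))"
          by (simp add: sum_subtractf swap)
        finally have "(\<Sum>k\<in>UNIV. \<lfloor>a $ k\<rfloor> * real (g f k) / real M) - (\<Sum>j\<in>UNIV. \<beta> $ j * real (f j)) - Z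
            = (\<Sum>j\<in>UNIV. (a v* A - \<beta> - z) $ j * real (f j)) - (\<Sum>k\<in>UNIV. a $ k * e k)"
          by (simp add: Z_def zZ sum_subtractf sum.distrib algebra_simps)
        also have "\<bar>\<dots>\<bar> \<le> 1/12 + 1/12"
        proof -
          have "\<bar>\<Sum>j\<in>UNIV. (a v* A - \<beta> - z) $ j * real (f j)\<bar> \<le> (\<Sum>j\<in>(UNIV::'m set). \<delta> * (\<kappa> / \<delta>))"
          proof (rule sum_abs[THEN order_trans], rule sum_mono)
            fix j
            have "f j < N" using f by (auto simp: T_def)
            then have "real (f j) \<le> \<kappa> / \<delta>" using N by linarith
            moreover have "\<bar>(a v* A - \<beta> - z) $ j\<bar> \<le> \<delta>"
              using z(2) unfolding infnorm_cart_less_iff by (simp add: less_imp_le)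
            ultimately show "\<bar>(a v* A - \<beta> - z) $ j * real (f j)\<bar> \<le> \<delta> * (\<kappa> / \<delta>)"
              using \<delta> unfolding abs_mult by (intro mult_mono) auto
          qed
          also have "\<dots> = 1/12" using \<delta> by (simp add: \<kappa>_def)
          finally have 1: "\<bar>\<Sum>j\<in>UNIV. (a v* A - \<beta> - z) $ j * real (f j)\<bar> \<le> 1/12" .
          have "\<bar>\<Sum>k\<in>UNIV. a $ k * e k\<bar> \<le> (\<Sum>k\<in>(UNIV::'k set). Q * (1 / M))"
          proof (rule sum_abs[THEN order_trans], rule sum_mono)
            fix k show "\<bar>a $ k * e k\<bar> \<le> Q * (1 / M)"
              using aQ[of k] e[of k] Q unfolding abs_mult by (intro mult_mono) auto
          qed
          also have "\<dots> = real ?D * Q / M" by simp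
          also have "\<dots> \<le> 1/12"
          proof -
            have "12 * real ?D * Q \<le> K * Q" using K(1) Q by (intro mult_right_mono) auto
            then show ?thesis using M by (simp add: field_simps)
          qed
          finally show ?thesis using 1 by linarith
        qed
        finally show ?thesis by (intro exI[of _ Z]) simp
      qed
    qed
    also have "real (card T) = real N ^ ?m" by (simp add: T_def card_PiE)
    finally have "real (card S) * real N ^ ?m \<le> 4 * real M ^ ?D" .
    moreover have "real (card S) * (\<kappa> / \<delta>) ^ ?m \<le> real (card S) * real N ^ ?m"
      using N \<kappa> \<delta> by (intro mult_left_mono power_mono) auto
    moreover have "4 * real M ^ ?D \<le> 4 * ((K + 1) * Q) ^ ?D"
      using M by (intro mult_left_mono power_mono) auto
    ultimately have "real (card S) * (\<kappa> / \<delta>) ^ ?m \<le> 4 * ((K + 1) ^ ?D * Q ^ ?D)"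
      unfolding power_mult_distrib by linarith
    then show "real (card S) \<le> C * Q ^ ?D * \<delta> ^ ?m"
      using \<kappa> \<delta> by (simp add: C_def power_mult_distrib power_divide field_simps)
  qed
qed

text \<open>Dirichlet's bound for the exponent. The point \<open>r = 0\<close> is always counted for \<open>\<beta> = 0\<close>, so
  \<open>C * Q^k * (Q powr (-1/w))^m \<ge> 1\<close> for all \<open>Q \<ge> 1\<close>, and the
  exponent \<open>k - m/w\<close> of \<open>Q\<close> cannot be negative; here \<open>k\<close> and \<open>m\<close> count the rows and columns of \<open>A\<close>.\<close>

lemma dirichlet_exponent_le:
  fixes A :: "real^'m^'k"
  assumes "c > 0" and w: "w > 0"
    and A: "\<And>q. q \<in> int_vectors \<Longrightarrow> q \<noteq> 0 \<Longrightarrow> c * infnorm q powr (-w) \<le> dist_int (A *v q)"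
  shows "real CARD('m) \<le> w * real CARD('k)"
proof (rule ccontr)
  let ?e = "real CARD('k) - real CARD('m) / w"
  assume "\<not> ?thesis"
  then have e: "?e < 0" using w by (simp add: field_simps)
  obtain C where C: "C > 0" and count:
    "\<And>Q \<delta> \<beta> S. Q \<ge> 1 \<Longrightarrow> \<delta> > 0 \<Longrightarrow> Q powr (-1/w) \<le> \<delta> \<Longrightarrow>
      S \<subseteq> {r \<in> int_vectors. infnorm r \<le> Q \<and> dist_int (r v* A - \<beta>) < \<delta>} \<Longrightarrow> finite S \<Longrightarrow>
      real (card S) \<le> C * Q ^ CARD('k) * \<delta> ^ CARD('m)"
    using card_int_vectors_near_int_le[OF assms(1,2) A] by blast
  have "1 / C \<le> Q powr ?e" if "Q \<ge> 1" for Q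
  proof -
    let ?\<delta> = "Q powr (-1/w)"
    have "?\<delta> > 0" using that by simp
    moreover have "dist_int (0 :: real^'m) \<le> 0"
      using dist_int_le[of 0 "0 :: real^'m"] by (simp add: infnorm_0)
    ultimately have "dist_int (0 :: real^'m) < ?\<delta>" by linarith
    then have "{0} \<subseteq> {r \<in> int_vectors. infnorm r \<le> Q \<and> dist_int (r v* A - 0) < ?\<delta>}"
      using that by (auto simp: infnorm_0)
    then have "1 \<le> C * Q ^ CARD('k) * ?\<delta> ^ CARD('m)"
      using count[OF that \<open>?\<delta> > 0\<close> order_refl, of "{0}" 0] by simp
    also have "\<dots> = C * Q powr ?e"
      using that by (simp add: powr_realpow[symmetric] powr_powr powr_add[symmetric])
    finally show ?thesis using C by (simp add: divide_le_eq mult.commute)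
  qed
  then have "\<forall>\<^sub>F Q in at_top. 1 / C \<le> Q powr ?e"
    using eventually_ge_at_top[of "1::real"] by (rule eventually_mono[rotated])
  moreover have "((\<lambda>Q. Q powr ?e) \<longlongrightarrow> 0) at_top"
    using e filterlim_ident by (rule tendsto_neg_powr)
  ultimately have "1 / C \<le> 0" by (intro tendsto_lowerbound) auto
  then show False using C by simp
qed

section \<open>Dyadic summation\<close>

text \<open>A form of Cauchy condensation in which the terms need not be monotone, only the factor \<open>\<psi>\<close>: on the
  block \<open>{2^k..<2^(k+1)}\<close> each term is at least \<open>\<psi> (2^(k+1)) powr a * (2^k) powr b\<close>, so the
  block dominates the condensed term at \<open>k + 1\<close> up to a constant.\<close>

lemma summable_dyadic_of_antimono:
  fixes \<psi> :: "nat \<Rightarrow> real"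
  assumes pos: "\<And>q. q \<ge> 1 \<Longrightarrow> \<psi> q > 0" and anti: "antimono_on {1..} \<psi>"
    and "a \<ge> 0" "b \<ge> 0"
    and summable: "summable (\<lambda>q. \<psi> (Suc q) powr a * real (Suc q) powr b)"
  shows "summable (\<lambda>k. (2 ^ k) powr (b + 1) * \<psi> (2 ^ k) powr a)"
proof -
  define f where "f q = \<psi> q powr a * real q powr b" for q
  define g where "g k = (2 ^ k) powr (b + 1) * \<psi> (2 ^ k) powr a" for k :: nat
  have nonneg: "f q \<ge> 0" "g k \<ge> 0" for q k by (auto simp: f_def g_def)
  have block: "g (Suc k) \<le> 2 powr (b + 1) * (\<Sum>q\<in>{2^k..<2^Suc k}. f q)" for k
  proof -
    have "(\<Sum>q\<in>{2^k..<2^Suc k::nat}. \<psi> (2 ^ Suc k) powr a * (2 ^ k) powr b) \<le> (\<Sum>q\<in>{2^k..<2^Suc k}. f q)"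
    proof (rule sum_mono)
      fix q :: nat assume q: "q \<in> {2^k..<2^Suc k}"
      have "(1::nat) \<le> 2 ^ k" by simp
      then have "q \<ge> 1" using q by (meson atLeastLessThan_iff order_trans)
      have "(1::nat) \<le> 2 ^ Suc k" by (rule one_le_power) simp
      have "\<psi> (2 ^ Suc k) \<le> \<psi> q"
        using \<open>q \<ge> 1\<close> \<open>1 \<le> 2 ^ Suc k\<close> q by (intro monotone_onD[OF anti]) auto
      moreover have "(2::real) ^ k \<le> real q"
        using q by (metis atLeastLessThan_iff of_nat_le_iff of_nat_numeral of_nat_power)
      ultimately show "\<psi> (2 ^ Suc k) powr a * (2 ^ k) powr b \<le> f q"
        unfolding f_def using pos[OF \<open>1 \<le> 2 ^ Suc k\<close>] \<open>a \<ge> 0\<close> \<open>b \<ge> 0\<close>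
        by (intro mult_mono powr_mono2) auto
    qed
    moreover have "g (Suc k) = 2 powr (b + 1) * (\<Sum>q\<in>{2^k..<2^Suc k::nat}. \<psi> (2 ^ Suc k) powr a * (2 ^ k) powr b)"
      by (simp add: g_def powr_add powr_mult mult_ac)
    ultimately show ?thesis by simp
  qed
  have blocks: "(\<Sum>k<n. \<Sum>q\<in>{2^k..<2^Suc k::nat}. f q) = (\<Sum>q\<in>{1..<2^n}. f q)" for n
  proof (induction n)
    case (Suc n)
    have "(1::nat) \<le> 2 ^ n" by simp
    then have "(\<Sum>q\<in>{1..<2^n}. f q) + (\<Sum>q\<in>{2^n..<2^Suc n}. f q) = (\<Sum>q\<in>{1..<2^Suc n}. f q)"
      by (rule sum.atLeastLessThan_concat) simp
    then show ?case using Suc.IH by simp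
  qed simp
  have "summable (\<lambda>k. g (Suc k))"
  proof (rule summableI_nonneg_bounded)
    fix n
    have "(\<Sum>k<n. g (Suc k)) \<le> (\<Sum>k<n. 2 powr (b + 1) * (\<Sum>q\<in>{2^k..<2^Suc k}. f q))"
      by (intro sum_mono block)
    also have "\<dots> = 2 powr (b + 1) * (\<Sum>q\<in>{1..<2^n}. f q)"
      unfolding sum_distrib_left[symmetric] blocks ..
    also have "(\<Sum>q\<in>{1..<2^n}. f q) = (\<Sum>q\<in>{0..<2^n - 1}. f (Suc q))"
      using sum.shift_bounds_Suc_ivl[of f 0 "2^n - 1"] by simp
    also have "\<dots> \<le> (\<Sum>q. f (Suc q))"
      using summable nonneg by (intro sum_le_suminf) (auto simp: f_def)
    finally show "(\<Sum>k<n. g (Suc k)) \<le> 2 powr (b + 1) * (\<Sum>q. f (Suc q))" by simp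
  qed (rule nonneg)
  then have "summable g" by (simp add: summable_Suc_iff)
  then show ?thesis by (simp only: g_def[abs_def])
qed

text \<open>Raising \<open>\<psi>\<close> to the threshold \<open>q powr (-1/w)\<close> adds at most a geometric series with ratio
  \<open>2 powr (b + 1 - a/w)\<close>.\<close>

lemma summable_dyadic_max:
  fixes \<psi> :: "nat \<Rightarrow> real"
  assumes pos: "\<And>q. q \<ge> 1 \<Longrightarrow> \<psi> q > 0" and anti: "antimono_on {1..} \<psi>"
    and "a \<ge> 0" "b \<ge> 0"
    and summable: "summable (\<lambda>q. \<psi> (Suc q) powr a * real (Suc q) powr b)"
    and "w > 0" and exponent: "b + 1 < a / w"
  shows "summable (\<lambda>k. (2 ^ k) powr (b + 1) * max (\<psi> (2 ^ k)) ((2 ^ k) powr (-1/w)) powr a)"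
proof (rule summable_comparison_test')
  have "summable (\<lambda>k. (2 ^ k) powr (b + 1) * \<psi> (2 ^ k) powr a)"
    using assms(1-5) by (rule summable_dyadic_of_antimono)
  moreover have "summable (\<lambda>k. (2 powr (b + 1 - a / w)) ^ k)"
    using exponent powr_less_mono[of "b + 1 - a / w" 0 2] by (intro summable_geometric) auto
  ultimately show "summable (\<lambda>k. (2 ^ k) powr (b + 1) * \<psi> (2 ^ k) powr a + (2 powr (b + 1 - a / w)) ^ k)"
    by (rule summable_add)
  fix k :: nat
  let ?u = "((2::real) ^ k) powr (-1/w)"
  have geometric: "(2 ^ k) powr (b + 1) * ?u powr a = (2 powr (b + 1 - a / w)) ^ k"
  proof -
    have "(2 powr (b + 1 - a / w)) ^ k = (2 powr (b + 1 - a / w)) powr real k"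
      by (simp add: powr_realpow)
    moreover have "(2::real) ^ k = 2 powr real k" by (simp add: powr_realpow)
    ultimately show ?thesis
      by (simp add: powr_powr powr_add[symmetric] algebra_simps)
  qed
  have "max (\<psi> (2 ^ k)) ?u powr a \<le> \<psi> (2 ^ k) powr a + ?u powr a"
    by (simp add: max_def)
  then have "(2 ^ k) powr (b + 1) * max (\<psi> (2 ^ k)) ?u powr a
      \<le> (2 ^ k) powr (b + 1) * (\<psi> (2 ^ k) powr a + ?u powr a)"
    by (rule mult_left_mono) simp
  also have "\<dots> = (2 ^ k) powr (b + 1) * \<psi> (2 ^ k) powr a + (2 powr (b + 1 - a / w)) ^ k"
    unfolding distrib_left geometric ..
  finally show "norm ((2 ^ k) powr (b + 1) * max (\<psi> (2 ^ k)) ?u powr a)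
      \<le> (2 ^ k) powr (b + 1) * \<psi> (2 ^ k) powr a + (2 powr (b + 1 - a / w)) ^ k"
    by simp
qed

section \<open>Approximable points of the affine subspace\<close>

definition lift :: "real \<Rightarrow> real^'d::finite \<Rightarrow> real^('d option)" where
  "lift t x = (\<chi> k. case k of None \<Rightarrow> t | Some i \<Rightarrow> x $ i)"

text \<open>An upper bound for the operator norm of \<open>x \<mapsto> x v* A\<close> with respect to the sup-norms.\<close>

definition abs_entry_sum :: "real^'m^'k \<Rightarrow> real" where
  "abs_entry_sum A = (\<Sum>k\<in>UNIV. \<Sum>j\<in>UNIV. \<bar>A $ k $ j\<bar>)"

lemma abs_entry_sum_nonneg: "0 \<le> abs_entry_sum A"
  by (auto simp: abs_entry_sum_def intro!: sum_nonneg)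

lemma abs_vector_matrix_mult_le:
  fixes A :: "real^'m^'k"
  assumes "\<And>k. \<bar>x $ k\<bar> \<le> e"
  shows "\<bar>(x v* A) $ j\<bar> \<le> abs_entry_sum A * e"
proof -
  have "e \<ge> 0" using assms[of undefined] by linarith
  have "\<bar>(x v* A) $ j\<bar> \<le> (\<Sum>k\<in>UNIV. \<bar>A $ k $ j\<bar> * e)"
    unfolding vector_matrix_mult_def vec_lambda_beta
    by (rule sum_abs[THEN order_trans], rule sum_mono) (auto simp: abs_mult mult.commute intro!: mult_right_mono assms)
  also have "\<dots> \<le> (\<Sum>k\<in>UNIV. (\<Sum>j\<in>UNIV. \<bar>A $ k $ j\<bar>) * e)"
    using \<open>e \<ge> 0\<close> by (intro sum_mono mult_right_mono member_le_sum) auto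
  finally show ?thesis by (simp add: abs_entry_sum_def sum_distrib_right)
qed

lemma norm_affine_graph_diff_le:
  fixes A :: "real^'m^('d::finite option)"
  assumes "\<And>i. \<bar>x $ i - x' $ i\<bar> \<le> e"
  shows "norm (vec_join x (tilde x v* A) - vec_join x' (tilde x' v* A))
    \<le> real CARD('d + 'm) * ((1 + abs_entry_sum A) * e)"
proof -
  let ?v = "vec_join x (tilde x v* A) - vec_join x' (tilde x' v* A)"
  have e: "e \<ge> 0" using assms[of undefined] by linarith
  have t: "\<bar>(tilde x - tilde x') $ k\<bar> \<le> e" for k
    using assms e by (cases k) (auto simp: tilde_def)
  have "\<bar>?v $ l\<bar> \<le> (1 + abs_entry_sum A) * e" for l
  proof (cases l)
    case (Inl i)
    have "\<bar>x $ i - x' $ i\<bar> \<le> 1 * e" using assms by simp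
    also have "\<dots> \<le> (1 + abs_entry_sum A) * e"
      using e abs_entry_sum_nonneg by (intro mult_right_mono) auto
    finally show ?thesis using Inl by (simp add: vec_join_def)
  next
    case (Inr j)
    then have "?v $ l = ((tilde x - tilde x') v* A) $ j"
      by (simp add: vec_join_def vector_matrix_mult_def sum_subtractf algebra_simps)
    then have "\<bar>?v $ l\<bar> \<le> abs_entry_sum A * e"
      using abs_vector_matrix_mult_le[of "tilde x - tilde x'" e A, OF t] by simp
    then show ?thesis using e by (simp add: algebra_simps)
  qed
  then have "(\<Sum>l\<in>UNIV. \<bar>?v $ l\<bar>) \<le> (\<Sum>l\<in>(UNIV :: ('d + 'm) set). (1 + abs_entry_sum A) * e)"
    by (intro sum_mono)
  then show ?thesis using norm_le_l1_cart[of ?v] by simp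
qed

text \<open>The vector \<open>r = (t, a)\<close> records \<open>t\<close> and the nearest integers to the first \<open>d\<close> coordinates of
  \<open>t y - \<theta>\<close>. Up to the error \<open>e\<close> in each entry, \<open>t * tilde x\<close> is \<open>r + (0, \<theta>\<^sub>1)\<close>, so
  \<open>t * (tilde x v* A) - \<theta>\<^sub>2\<close> being near an integer vector means that
  \<open>r v* A\<close> is near \<open>\<theta>\<^sub>2 - (0, \<theta>\<^sub>1) v* A\<close> modulo integers.\<close>

lemma int_vector_of_approximation:
  fixes A :: "real^'m^('d::finite option)" and \<theta> :: "real^('d + 'm)"
  assumes "dist_int (t *\<^sub>R vec_join x (tilde x v* A) - \<theta>) < e" and "t \<in> \<int>"
  obtains r where "r \<in> int_vectors" "r $ None = t"
    "\<And>i. \<bar>t * x $ i - r $ Some i - \<theta> $ Inl i\<bar> < e"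
    "dist_int (r v* A - ((\<chi> j. \<theta> $ Inr j) - lift 0 (\<chi> i. \<theta> $ Inl i) v* A)) < (1 + abs_entry_sum A) * e"
proof -
  obtain z where z: "z \<in> int_vectors" "infnorm (t *\<^sub>R vec_join x (tilde x v* A) - \<theta> - z) < e"
    using assms(1) by (rule dist_int_lessE)
  let ?r = "lift t (\<chi> i. z $ Inl i)" and ?h = "lift 0 (\<chi> i. \<theta> $ Inl i)"
  let ?z = "\<chi> j. z $ Inr j"
  have zc: "\<bar>t * vec_join x (tilde x v* A) $ l - \<theta> $ l - z $ l\<bar> < e" for l
    using z(2) unfolding infnorm_cart_less_iff by simp
  have zl: "\<bar>t * x $ i - z $ Inl i - \<theta> $ Inl i\<bar> < e" for i
    using zc[of "Inl i"] by (simp add: vec_join_def algebra_simps)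
  have e: "e > 0" using zl[of undefined] by linarith
  show thesis
  proof
    show "?r \<in> int_vectors"
      using z(1) assms(2) by (auto simp: int_vectors_def lift_def split: option.split)
    show "?r $ None = t" by (simp add: lift_def)
    show "\<bar>t * x $ i - ?r $ Some i - \<theta> $ Inl i\<bar> < e" for i
      using zl by (simp add: lift_def)
    \<comment> \<open>\<open>?w\<close> below is the error in approximating \<open>t * tilde x\<close>; its leading entry vanishes.\<close>
    have "infnorm (?r v* A - ((\<chi> j. \<theta> $ Inr j) - ?h v* A) - ?z) < (1 + abs_entry_sum A) * e"
      unfolding infnorm_cart_less_iff
    proof
      fix j
      let ?w = "?r + ?h - t *\<^sub>R tilde x"
      have "\<bar>?w $ k\<bar> \<le> e" for k
        using e zl less_imp_le by (cases k) (auto simp: lift_def tilde_def abs_minus_commute algebra_simps abs_le_iff abs_less_iff)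
      then have "\<bar>(?w v* A) $ j\<bar> \<le> abs_entry_sum A * e"
        by (rule abs_vector_matrix_mult_le)
      moreover have "\<bar>t * (tilde x v* A) $ j - \<theta> $ Inr j - z $ Inr j\<bar> < e"
        using zc[of "Inr j"] by (simp add: vec_join_def)
      moreover have "(?r v* A - ((\<chi> j. \<theta> $ Inr j) - ?h v* A) - ?z) $ j
        = (?w v* A) $ j + (t * (tilde x v* A) $ j - \<theta> $ Inr j - z $ Inr j)"
        by (simp add: vector_matrix_mult_def sum_subtractf sum.distrib sum_distrib_left algebra_simps)
      ultimately show "\<bar>(?r v* A - ((\<chi> j. \<theta> $ Inr j) - ?h v* A) - ?z) $ j\<bar> < (1 + abs_entry_sum A) * e"
        by (simp add: distrib_right)
    qed
    moreover have "?z \<in> int_vectors" using z(1) by (simp add: int_vectors_def)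
    ultimately show "dist_int (?r v* A - ((\<chi> j. \<theta> $ Inr j) - ?h v* A)) < (1 + abs_entry_sum A) * e"
      by (meson dist_int_le le_less_trans)
  qed
qed

text \<open>Over a bounded range of \<open>x\<close>, block \<open>k\<close> contributes the integer vectors \<open>r = (q, a)\<close> with
  \<open>q \<ge> 2^k\<close> and \<open>\<bar>r\<bar> \<le> B * 2^k\<close>. There are at most \<open>O((2^k)^(d+1) * \<phi> k^m)\<close> of them with
  \<open>r v* A\<close> close to \<open>\<beta>\<close> modulo integers, and each accounts for a patch of diameter
  \<open>O(\<phi> k / 2^k)\<close>. The function \<open>\<phi>\<close> bounds \<open>\<psi>\<close> on the blocks and stays above the
  threshold of the counting bound.\<close>

lemma hausdorff_measure_bounded_approximable_eq_0:
  fixes A :: "real^'m^('d::finite option)" and \<theta> :: "real^('d + 'm)"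
    and \<phi> \<psi> :: "nat \<Rightarrow> real" and R s c w :: real
  assumes "R \<ge> 0" and s0: "s > 0" and "c > 0" and w0: "w > 0"
    and lower_bound: "\<And>q. q \<in> int_vectors \<Longrightarrow> q \<noteq> 0 \<Longrightarrow> c * infnorm q powr (-w) \<le> dist_int (A *v q)"
    and \<psi>_le: "\<And>k q. 2 ^ k \<le> q \<Longrightarrow> \<psi> q \<le> \<phi> k"
    and threshold: "\<And>k. (2 ^ k) powr (-1/w) \<le> \<phi> k"
    and \<phi>_le: "\<And>k. \<phi> k \<le> \<phi> 0"
    and summable_\<phi>: "summable (\<lambda>k. (2 ^ k) powr (real CARD('d) + 1 - s) * \<phi> k powr (real CARD('m) + s))"
  shows "hausdorff_measure s {y \<in> approximable \<psi> \<theta>. \<exists>x. y = vec_join x (tilde x v* A) \<and> (\<forall>i. \<bar>x $ i\<bar> \<le> R)} = 0"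
proof -
  define d m where "d = CARD('d)" and "m = CARD('m)"
  note summable_\<phi> = summable_\<phi>[folded d_def m_def]
  have card_option: "CARD('d option) = d + 1" by (simp add: d_def)
  obtain C where C: "C > 0" and count:
    "\<And>Q \<delta> \<beta> S. Q \<ge> 1 \<Longrightarrow> \<delta> > 0 \<Longrightarrow> Q powr (-1/w) \<le> \<delta> \<Longrightarrow>
      S \<subseteq> {r \<in> int_vectors. infnorm r \<le> Q \<and> dist_int (r v* A - \<beta>) < \<delta>} \<Longrightarrow> finite S \<Longrightarrow>
      real (card S) \<le> C * Q ^ (d + 1) * \<delta> ^ m"
    using card_int_vectors_near_int_le[OF \<open>c > 0\<close> w0 lower_bound] unfolding card_option m_def by blast
  have \<phi>pos: "\<phi> k > 0" for k
  proof -
    have "0 < ((2::real) ^ k) powr (-1/w)" by simp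
    then show ?thesis using threshold[of k] by linarith
  qed
  define L where "L = 1 + abs_entry_sum A"
  have L: "L \<ge> 1" using abs_entry_sum_nonneg[of A] by (simp add: L_def)
  define \<beta> where "\<beta> = (\<chi> j. \<theta> $ Inr j) - lift 0 (\<chi> i. \<theta> $ Inl i) v* A"
  define c\<^sub>1 where "c\<^sub>1 = real CARD('d + 'm) * (L * 2)"
  have c1: "c\<^sub>1 > 0"
  proof -
    have "0 < real CARD('d + 'm)" by (simp only: of_nat_0_less_iff zero_less_card_finite)
    then show ?thesis unfolding c\<^sub>1_def using L by (intro mult_pos_pos) linarith+
  qed
  define \<rho> where "\<rho> k = c\<^sub>1 * (\<phi> k / 2 ^ k)" for k

  \<comment> \<open>The points over the ball of radius \<open>\<phi> k / 2^k\<close> around the rational point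
    \<open>(a + \<theta>\<^sub>1) / q\<close> that belongs to \<open>r = (q, a)\<close>.\<close>
  define patch where "patch k r = {vec_join x (tilde x v* A) |x.
    \<forall>i. \<bar>x $ i - (r $ Some i + \<theta> $ Inl i) / r $ None\<bar> \<le> \<phi> k / 2 ^ k}" for k :: nat and r :: "real^('d option)"
  have patch_diam: "norm (y - y') \<le> \<rho> k" if "y \<in> patch k r" "y' \<in> patch k r" for y y' k r
  proof -
    obtain x x' where x: "y = vec_join x (tilde x v* A)" "y' = vec_join x' (tilde x' v* A)"
      "\<And>i. \<bar>x $ i - (r $ Some i + \<theta> $ Inl i) / r $ None\<bar> \<le> \<phi> k / 2 ^ k"
      "\<And>i. \<bar>x' $ i - (r $ Some i + \<theta> $ Inl i) / r $ None\<bar> \<le> \<phi> k / 2 ^ k"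
      using \<open>y \<in> patch k r\<close> \<open>y' \<in> patch k r\<close> unfolding patch_def by blast
    have "\<bar>x $ i - x' $ i\<bar> \<le> 2 * (\<phi> k / 2 ^ k)" for i using x(3,4)[of i] by linarith
    then have "norm (vec_join x (tilde x v* A) - vec_join x' (tilde x' v* A))
      \<le> real CARD('d + 'm) * ((1 + abs_entry_sum A) * (2 * (\<phi> k / 2 ^ k)))"
      by (rule norm_affine_graph_diff_le)
    then show ?thesis unfolding x(1,2) by (simp add: \<rho>_def c\<^sub>1_def L_def mult_ac)
  qed

  \<comment> \<open>\<open>B\<close> is chosen so that every \<open>r\<close> arising from \<open>q < 2^(k+1)\<close> has \<open>\<bar>r\<bar> \<le> B * 2^k\<close>.\<close>
  define B where "B = 2 + 2 * R + infnorm \<theta> + \<phi> 0"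
  have B: "B \<ge> 2" "B \<ge> 2 * R + infnorm \<theta> + \<phi> 0"
    using \<phi>pos[of 0] infnorm_pos_le[of \<theta>] \<open>R \<ge> 0\<close> by (auto simp: B_def)
  define F where "F k = {r \<in> int_vectors. 2 ^ k \<le> r $ None \<and> infnorm r \<le> B * 2 ^ k \<and> dist_int (r v* A - \<beta>) < L * \<phi> k}"
    for k :: nat
  have card_F: "finite (F k) \<and> real (card (F k)) \<le> C * (B * 2 ^ k) ^ (d + 1) * (L * \<phi> k) ^ m" for k
  proof -
    let ?b = "C * (B * 2 ^ k) ^ (d + 1) * (L * \<phi> k) ^ m"
    have "card S \<le> nat \<lfloor>?b\<rfloor>" if "S \<subseteq> F k" "finite S" for S
    proof -
      have BQ: "(2::real) ^ k \<le> B * 2 ^ k" using B(1) by simp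
      moreover have "(1::real) \<le> 2 ^ k" by simp
      ultimately have "1 \<le> B * 2 ^ k" by linarith
      moreover have "L * \<phi> k > 0" using L \<phi>pos by simp
      moreover have "(B * 2 ^ k) powr (-1/w) \<le> L * \<phi> k"
      proof -
        have "(B * 2 ^ k) powr (-1/w) \<le> (2 ^ k) powr (-1/w)"
          using BQ w0 by (intro powr_mono2') auto
        also have "\<dots> \<le> 1 * \<phi> k" using threshold[of k] by simp
        also have "\<dots> \<le> L * \<phi> k" using L \<phi>pos[of k] by (intro mult_right_mono) auto
        finally show ?thesis .
      qed
      ultimately have "real (card S) \<le> ?b"
        using that by (intro count[of _ _ _ \<beta>]) (auto simp: F_def)
      then show ?thesis by linarith
    qed
    then have "finite (F k) \<and> card (F k) \<le> nat \<lfloor>?b\<rfloor>"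
      by (rule finite_if_finite_subsets_card_bdd)
    moreover have "?b \<ge> 0" using C B L \<phi>pos[of k] by simp
    ultimately show ?thesis by linarith
  qed
  show ?thesis
  proof (rule hausdorff_measure_limsup_eq_0[OF s0])
    show "finite (F k)" for k using card_F by blast
    show "bounded (patch k r)" for k r
      unfolding bounded_two_points dist_norm using patch_diam by blast
    show "0 \<le> \<rho> k" for k using c1 \<phi>pos[of k] by (simp add: \<rho>_def)
    then show "diameter (patch k r) \<le> \<rho> k" for k r
      using patch_diam by (intro diameter_le) auto
    show "\<rho> \<longlonglongrightarrow> 0"
    proof (rule tendsto_sandwich[of "\<lambda>_. 0" \<rho> _ "\<lambda>k. (c\<^sub>1 * \<phi> 0) * (1/2) ^ k"])
      show "\<forall>\<^sub>F k in sequentially. 0 \<le> \<rho> k" using \<open>\<And>k. 0 \<le> \<rho> k\<close> by simp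
      have "\<rho> k \<le> (c\<^sub>1 * \<phi> 0) * (1/2) ^ k" for k
        using mult_left_mono[OF \<phi>_le[of k], of "c\<^sub>1 / 2 ^ k"] c1
        by (simp add: \<rho>_def power_divide mult_ac)
      then show "\<forall>\<^sub>F k in sequentially. \<rho> k \<le> (c\<^sub>1 * \<phi> 0) * (1/2) ^ k" by simp
      show "(\<lambda>k. (c\<^sub>1 * \<phi> 0) * (1/2) ^ k) \<longlonglongrightarrow> 0"
        by (intro tendsto_mult_right_zero LIMSEQ_power_zero) simp
    qed simp
    show "summable (\<lambda>k. real (card (F k)) * \<rho> k powr s)"
    proof (rule summable_comparison_test')
      let ?c = "C * B ^ (d + 1) * L ^ m * c\<^sub>1 powr s"
      show "summable (\<lambda>k. ?c * ((2 ^ k) powr (real d + 1 - s) * \<phi> k powr (real m + s)))"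
        by (rule summable_mult[OF summable_\<phi>])
      fix k
      have \<rho>_powr: "\<rho> k powr s = c\<^sub>1 powr s * (\<phi> k powr s * (2 ^ k) powr (- s))"
        using c1 \<phi>pos[of k] by (simp add: \<rho>_def powr_mult powr_divide powr_minus_divide)
      have \<phi>_power: "(L * \<phi> k) ^ m = L ^ m * \<phi> k powr real m"
        using \<phi>pos[of k] by (simp add: power_mult_distrib powr_realpow)
      have Q_power: "(B * 2 ^ k) ^ (d + 1) = B ^ (d + 1) * (2 ^ k) powr (real d + 1)"
      proof -
        have "(2 ^ k) powr (real d + 1) = (2 ^ k) powr real (d + 1)" by (simp add: add.commute)
        also have "\<dots> = ((2::real) ^ k) ^ (d + 1)" by (subst powr_realpow) auto
        finally show ?thesis by (simp only: power_mult_distrib)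
      qed
      have "real (card (F k)) * \<rho> k powr s \<le> C * (B * 2 ^ k) ^ (d + 1) * (L * \<phi> k) ^ m * \<rho> k powr s"
        using card_F by (intro mult_right_mono) auto
      also have "\<dots> = ?c * (((2 ^ k) powr (real d + 1) * (2 ^ k) powr (- s)) * (\<phi> k powr real m * \<phi> k powr s))"
        unfolding \<rho>_powr \<phi>_power Q_power by (simp only: mult_ac)
      also have "\<dots> = ?c * ((2 ^ k) powr (real d + 1 - s) * \<phi> k powr (real m + s))"
        by (simp only: powr_add[symmetric] add_uminus_conv_diff)
      finally show "norm (real (card (F k)) * \<rho> k powr s) \<le> ?c * ((2 ^ k) powr (real d + 1 - s) * \<phi> k powr (real m + s))"
        by simp
    qed
    fix y assume "y \<in> {y \<in> approximable \<psi> \<theta>. \<exists>x. y = vec_join x (tilde x v* A) \<and> (\<forall>i. \<bar>x $ i\<bar> \<le> R)}"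
    then obtain x where x: "y = vec_join x (tilde x v* A)" "\<And>i. \<bar>x $ i\<bar> \<le> R"
      and inf: "infinite {q. q \<ge> 1 \<and> dist_int (real q *\<^sub>R y - \<theta>) < \<psi> q}"
      unfolding approximable_def by blast
    show "infinite {k. y \<in> (\<Union>r\<in>F k. patch k r)}"
      unfolding infinite_nat_iff_unbounded_le
    proof
      fix l
      obtain q where q: "q \<ge> 2 ^ l" "q \<ge> 1" "dist_int (real q *\<^sub>R y - \<theta>) < \<psi> q"
        using inf unfolding infinite_nat_iff_unbounded_le by blast
      obtain k where k: "2 ^ k \<le> q" "q < 2 ^ Suc k"
        using ex_power_ivl1[of 2 q] q(2) by auto
      have "(2::nat) ^ l < 2 ^ Suc k" using q(1) k(2) by linarith
      then have "l \<le> k" using power_less_imp_less_exp[of "2::nat" l "Suc k"] by simp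
      have "(2::real) ^ k \<le> real q" "real q \<le> 2 * 2 ^ k"
      proof -
        show "(2::real) ^ k \<le> real q" using k(1) by (metis of_nat_le_iff of_nat_numeral of_nat_power)
        have "real q \<le> real (2 ^ Suc k)" using k(2) by linarith
        then show "real q \<le> 2 * 2 ^ k" by simp
      qed
      note kq = this
      have qpos: "real q > 0" using q(2) by simp
      obtain r where r: "r \<in> int_vectors" "r $ None = real q"
        "\<And>i. \<bar>real q * x $ i - r $ Some i - \<theta> $ Inl i\<bar> < \<psi> q"
        "dist_int (r v* A - \<beta>) < L * \<psi> q"
        using int_vector_of_approximation[OF q(3)[unfolded x(1)]] unfolding \<beta>_def L_def by auto
      have "\<psi> q \<le> \<phi> k" using k(1) by (rule \<psi>_le)
      have "r \<in> F k"
        unfolding F_def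
      proof (intro CollectI conjI)
        show "2 ^ k \<le> r $ None" using kq r(2) by simp
        show "dist_int (r v* A - \<beta>) < L * \<phi> k"
          using r(4) mult_left_mono[OF \<open>\<psi> q \<le> \<phi> k\<close>, of L] L by linarith
        show "infnorm r \<le> B * 2 ^ k"
          unfolding infnorm_cart_le_iff
        proof
          fix l
          show "\<bar>r $ l\<bar> \<le> B * 2 ^ k"
          proof (cases l)
            case None
            have "2 * 2 ^ k \<le> B * 2 ^ k" using B(1) by (intro mult_right_mono) auto
            then show ?thesis unfolding None r(2) using kq by linarith
          next
            case (Some i)
            have "\<psi> q \<le> \<phi> 0" using \<psi>_le[of 0 q] q(2) by simp
            have "\<bar>r $ Some i\<bar> \<le> real q * \<bar>x $ i\<bar> + \<bar>\<theta> $ Inl i\<bar> + \<psi> q"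
            proof -
              have "\<bar>real q * x $ i\<bar> = real q * \<bar>x $ i\<bar>" by (simp add: abs_mult)
              then show ?thesis using r(3)[of i] by linarith
            qed
            also have "\<dots> \<le> (2 * 2 ^ k) * R + infnorm \<theta> * 2 ^ k + \<phi> 0 * 2 ^ k"
            proof (intro add_mono mult_mono)
              have one: "(1::real) \<le> 2 ^ k" by simp
              show "\<bar>\<theta> $ Inl i\<bar> \<le> infnorm \<theta> * 2 ^ k"
                using mult_left_mono[OF one infnorm_pos_le[of \<theta>]] component_le_infnorm_cart[of \<theta> "Inl i"] by linarith
              show "\<psi> q \<le> \<phi> 0 * 2 ^ k"
                using mult_left_mono[OF one, of "\<phi> 0"] \<phi>pos[of 0] \<open>\<psi> q \<le> \<phi> 0\<close> by linarith
            qed (use kq x(2) in auto)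
            also have "\<dots> = (2 * R + infnorm \<theta> + \<phi> 0) * 2 ^ k" by (simp add: algebra_simps)
            also have "\<dots> \<le> B * 2 ^ k" using B(2) by (intro mult_right_mono) auto
            finally show ?thesis using Some by simp
          qed
        qed
      qed (fact r(1))
      moreover have "y \<in> patch k r"
        unfolding patch_def
      proof (intro CollectI exI conjI allI)
        show "y = vec_join x (tilde x v* A)" by fact
        fix i
        have "x $ i - (r $ Some i + \<theta> $ Inl i) / r $ None = (real q * x $ i - r $ Some i - \<theta> $ Inl i) / real q"
          using qpos r(2) by (simp add: field_simps)
        then have "\<bar>x $ i - (r $ Some i + \<theta> $ Inl i) / r $ None\<bar> = \<bar>real q * x $ i - r $ Some i - \<theta> $ Inl i\<bar> / real q"
          by simp
        also have "\<dots> \<le> \<phi> k / 2 ^ k"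
          using r(3)[of i] \<open>\<psi> q \<le> \<phi> k\<close> kq \<phi>pos[of k] by (intro frac_le) auto
        finally show "\<bar>x $ i - (r $ Some i + \<theta> $ Inl i) / r $ None\<bar> \<le> \<phi> k / 2 ^ k" .
      qed
      ultimately show "\<exists>j\<ge>l. j \<in> {k. y \<in> (\<Union>r\<in>F k. patch k r)}"
        using \<open>l \<le> k\<close> by blast
    qed
  qed
qed

section \<open>Convergence implies measure zero\<close>

theorem theorem2p5:
  fixes A :: "real^'m^('d::finite option)"
    and d m n :: nat
    and \<omega> s :: real
    and \<psi> :: "nat \<Rightarrow> real"
    and \<theta> :: "real^('d + 'm)"
  assumes "d = CARD('d)" and "m = CARD('m)" and "n = d + m"
    and "diophantine_exponent A = ereal \<omega>" and "\<omega> < real n"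
    and "(\<omega> * (real d + 1) - real m) / (\<omega> + 1) < s" and "s \<le> real d"
    and "\<forall>q\<ge>1. \<psi> q > 0"
    and "antimono_on {1..} \<psi>"
    and "summable (\<lambda>q. \<psi> (Suc q) powr (real m + s) * real (Suc q) powr (real d - s))"
  shows "hausdorff_measure s (approximable \<psi> \<theta> \<inter> affine_graph A) = 0"
proof -
  note d = assms(1) and m = assms(2) and exponent = assms(4) and s_lower = assms(6) and sd = assms(7)
    and anti = assms(9) and summable_\<psi> = assms(10)
  have pos: "\<psi> q > 0" if "q \<ge> 1" for q using assms(8) that by simp
  have card_option: "CARD('d option) = d + 1" by (simp add: d)
  have m1: "real m \<ge> 1" using m zero_less_card_finite[where 'a='m] by linarith

  have lower_bound: "\<exists>c>0. \<forall>q\<in>int_vectors. q \<noteq> 0 \<longrightarrow> c * infnorm q powr (-w) \<le> dist_int (A *v q)"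
    if w: "w > \<omega>" for w
  proof -
    have "diophantine_exponent A < ereal w" using w exponent by simp
    from diophantine_exponent_less_imp_lower_bound[OF this] show ?thesis by metis
  qed
  have dirichlet: "real m \<le> w * (real d + 1)" if w: "w > \<omega>" "w > 0" for w
  proof -
    obtain c where "c > 0" "\<forall>q\<in>int_vectors. q \<noteq> 0 \<longrightarrow> c * infnorm q powr (-w) \<le> dist_int (A *v q)"
      using lower_bound[OF w(1)] by blast
    then show ?thesis using dirichlet_exponent_le[of c w A] w(2) card_option m by (simp add: add.commute)
  qed
  have \<omega>_ge: "real m / (real d + 1) \<le> \<omega>"
  proof (rule ccontr)
    assume "\<not> ?thesis"
    moreover have "real m / (real d + 1) > 0" using m1 by simp
    ultimately obtain w where w: "max \<omega> 0 < w" "w < real m / (real d + 1)"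
      using dense[of "max \<omega> 0" "real m / (real d + 1)"] by auto
    then show False using dirichlet[of w] by (simp add: field_simps)
  qed
  moreover have "real m / (real d + 1) > 0" using m1 by simp
  ultimately have \<omega>0: "\<omega> > 0" by linarith
  have "0 \<le> (\<omega> * (real d + 1) - real m) / (\<omega> + 1)"
    using \<omega>_ge \<omega>0 by (simp add: field_simps)
  then have s0: "s > 0" using s_lower by linarith

  \<comment> \<open>The condition on \<open>s\<close> says \<open>\<omega> * ?E < m + s\<close>, so some \<open>w > \<omega>\<close> satisfies it as well.\<close>
  let ?E = "real d + 1 - s"
  have E1: "?E \<ge> 1" using sd by simp
  have "\<omega> < (real m + s) / ?E"
    using s_lower \<omega>0 E1 by (simp add: field_simps)
  then obtain w where w: "\<omega> < w" "w < (real m + s) / ?E" using dense by blast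
  have w0: "w > 0" using w \<omega>0 by linarith
  have exponent_neg: "?E - (real m + s) / w < 0"
    using w w0 E1 by (simp add: field_simps)
  obtain c where c: "c > 0" "\<And>q. q \<in> int_vectors \<Longrightarrow> q \<noteq> 0 \<Longrightarrow> c * infnorm q powr (-w) \<le> dist_int (A *v q)"
    using lower_bound[OF w(1)] by blast
  define \<phi> where "\<phi> k = max (\<psi> (2 ^ k)) ((2 ^ k) powr (-1/w))" for k :: nat
  have \<psi>_le: "\<psi> q \<le> \<phi> k" if "2 ^ k \<le> q" for k q
  proof -
    have "(1::nat) \<le> 2 ^ k" by simp
    then have "1 \<le> q" using that by (rule order_trans)
    then have "\<psi> q \<le> \<psi> (2 ^ k)" using that by (intro monotone_onD[OF anti]) auto
    then show ?thesis by (simp add: \<phi>_def)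
  qed
  have threshold: "(2 ^ k) powr (-1/w) \<le> \<phi> k" for k by (simp add: \<phi>_def)
  have \<phi>_le: "\<phi> k \<le> \<phi> 0" for k
  proof -
    have "(1::nat) \<le> 2 ^ k" by simp
    then have "\<psi> (2 ^ k) \<le> \<psi> (2 ^ 0)" by (intro monotone_onD[OF anti]) auto
    moreover have "(2 ^ k) powr (-1/w) \<le> (2 ^ k) powr (0::real)"
      using w0 by (intro powr_mono) auto
    ultimately show ?thesis by (auto simp: \<phi>_def)
  qed
  have summable_\<phi>: "summable (\<lambda>k. (2 ^ k) powr ?E * \<phi> k powr (real m + s))"
  proof -
    have "real d - s + 1 < (real m + s) / w" using exponent_neg by simp
    then have "summable (\<lambda>k. (2 ^ k) powr (real d - s + 1) * \<phi> k powr (real m + s))"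
      unfolding \<phi>_def using pos anti sd s0 summable_\<psi> w0 by (intro summable_dyadic_max) auto
    then show ?thesis by (simp only: diff_add_eq)
  qed

  define E where "E R = {y \<in> approximable \<psi> \<theta>. \<exists>x. y = vec_join x (tilde x v* A) \<and> (\<forall>i. \<bar>x $ i\<bar> \<le> real R)}"
    for R :: nat
  have null: "hausdorff_measure s (E R) = 0" for R
    unfolding E_def
  proof (rule hausdorff_measure_bounded_approximable_eq_0[OF _ s0 c(1) w0 c(2) \<psi>_le threshold \<phi>_le])
    show "summable (\<lambda>k. (2 ^ k) powr (real CARD('d) + 1 - s) * \<phi> k powr (real CARD('m) + s))"
      using summable_\<phi> by (simp only: d m)
  qed auto
  have "approximable \<psi> \<theta> \<inter> affine_graph A \<subseteq> (\<Union>R. E R)"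
  proof
    fix y assume y: "y \<in> approximable \<psi> \<theta> \<inter> affine_graph A"
    then obtain x where x: "y = vec_join x (tilde x v* A)" by (auto simp: affine_graph_def)
    obtain R :: nat where "infnorm x \<le> real R" using real_arch_simple by blast
    then have "y \<in> E R" using y x unfolding E_def infnorm_cart_le_iff by blast
    then show "y \<in> (\<Union>R. E R)" by blast
  qed
  then have "(\<Union>R. E R) = approximable \<psi> \<theta> \<inter> affine_graph A"
    unfolding E_def affine_graph_def by blast
  then show ?thesis using hausdorff_measure_UN_eq_0[of s E, OF null] by simp
qed

end
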